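(* Let $T>0$ and let $\mathsf H:[0,T]\to\mathbb C^{N\times N}$ be continuously differentiable with $\mathsf H(t)$ Hermitian for every $t$. Put $\mathsf K(t)=i\dot{\mathsf H}(t)+\mathsf H(t)^2$ and $$\mathcal K(t)=\begin{bmatrix}\operatorname{Re}\mathsf K(t)&-\operatorname{Im}\mathsf K(t)\\ \operatorname{Im}\mathsf K(t)&\operatorname{Re}\mathsf K(t)\end{bmatrix}\in\mathbb R^{2N\times 2N}.$$ Let $\psi:[0,T]\to\mathbb C^N$ be twice differentiable and let $\varphi(t)=\begin{bmatrix}\operatorname{Re}\psi(t)\\ \operatorname{Im}\psi(t)\end{bmatrix}\in\mathbb R^{2N}$. Then $\psi$ satisfies $$\ddot\psi(t)=-\mathsf K(t)\psi(t)\quad\text{on }[0,T]$$ if and only if $\varphi$ satisfies $$\ddot\varphi(t)=-\mathcal K(t)\varphi(t)\quad\text{on }[0,T].$$ Moreover, the initial condition $\dot\psi(0)=-i\mathsf H(0)\psi(0)$ holds if and only if $$\dot\varphi(0)=-\begin{bmatrix}-\operatorname{Im}\mathsf H(0)&-\operatorname{Re}\mathsf H(0)\\ \operatorname{Re}\mathsf H(0)&-\operatorname{Im}\mathsf H(0)\end{bmatrix}\varphi(0),$$ so that the complex initial value problem for $\psi$ (second-order equation together with the condition on $\dot\psi(0)$) is equivalent to the real initial value problem for $\varphi$.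
   Context: Overdots denote derivatives with respect to $t$ (one-sided at the endpoints of $[0,T]$). $\operatorname{Re}$ and $\operatorname{Im}$ of matrices and vectors are taken entrywise. $N=2^n$ is the dimension of the state space of $n$ qubits; $\mathsf H(t)$ is a time-dependent Hamiltonian, with $\hbar=1$. *)

theory Defs
  imports "HOL-Analysis.Analysis"
begin

(* The within-filter makes the derivative one-sided at 0 and T; the value is
   unspecified where f is not differentiable. *)
definition tderiv :: "real \<Rightarrow> (real \<Rightarrow> 'a::real_normed_vector) \<Rightarrow> real \<Rightarrow> 'a" where
  "tderiv T f t = vector_derivative f (at t within {0..T})"

definition continuously_differentiable :: "real \<Rightarrow> (real \<Rightarrow> 'a::real_normed_vector) \<Rightarrow> bool" where
  "continuously_differentiable T f \<longleftrightarrow>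
     f differentiable_on {0..T} \<and> continuous_on {0..T} (tderiv T f)"

definition twice_differentiable :: "real \<Rightarrow> (real \<Rightarrow> 'a::real_normed_vector) \<Rightarrow> bool" where
  "twice_differentiable T f \<longleftrightarrow>
     f differentiable_on {0..T} \<and> tderiv T f differentiable_on {0..T}"

definition hermitian :: "complex^'n^'n \<Rightarrow> bool" where
  "hermitian A \<longleftrightarrow> (\<forall>i j. A $ j $ i = cnj (A $ i $ j))"

definition Re_vec :: "complex^'n \<Rightarrow> real^'n" where
  "Re_vec v = (\<chi> i. Re (v $ i))"

definition Im_vec :: "complex^'n \<Rightarrow> real^'n" where
  "Im_vec v = (\<chi> i. Im (v $ i))"

(* Vectors of length 2N are indexed by the sum type 'n + 'n:
   Inl is the first block of N coordinates, Inr the second. *)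
definition block_vec :: "'a^'n \<Rightarrow> 'a^'n \<Rightarrow> 'a^('n + 'n)" where
  "block_vec u v = (\<chi> k. case k of Inl i \<Rightarrow> u $ i | Inr i \<Rightarrow> v $ i)"

(* block_mat A B C D has first block row A, B and second block row C, D. *)
definition block_mat ::
    "'a^'n^'n \<Rightarrow> 'a^'n^'n \<Rightarrow> 'a^'n^'n \<Rightarrow> 'a^'n^'n \<Rightarrow> 'a^('n + 'n)^('n + 'n)" where
  "block_mat A B C D = (\<chi> k l.
     case k of
       Inl i \<Rightarrow> (case l of Inl j \<Rightarrow> A $ i $ j | Inr j \<Rightarrow> B $ i $ j)
     | Inr i \<Rightarrow> (case l of Inl j \<Rightarrow> C $ i $ j | Inr j \<Rightarrow> D $ i $ j))"

definition complex_K :: "real \<Rightarrow> (real \<Rightarrow> complex^'n^'n) \<Rightarrow> real \<Rightarrow> complex^'n^'n" where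
  "complex_K T H t = map_matrix ((*) \<i>) (tderiv T H t) + H t ** H t"

definition real_K :: "real \<Rightarrow> (real \<Rightarrow> complex^'n^'n) \<Rightarrow> real \<Rightarrow> real^('n + 'n)^('n + 'n)" where
  "real_K T H t =
     block_mat (map_matrix Re (complex_K T H t)) (- map_matrix Im (complex_K T H t))
               (map_matrix Im (complex_K T H t)) (map_matrix Re (complex_K T H t))"

(* A solution is by definition twice differentiable, so no unspecified derivative enters. *)
definition solves_second_order ::
    "real \<Rightarrow> (real \<Rightarrow> 'a::real_normed_field^'n^'n) \<Rightarrow> (real \<Rightarrow> 'a^'n) \<Rightarrow> bool" where
  "solves_second_order T A x \<longleftrightarrow>
     twice_differentiable T x \<and>
     (\<forall>t\<in>{0..T}. tderiv T (tderiv T x) t = - (A t *v x t))"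

definition initial_velocity ::
    "real \<Rightarrow> (real \<Rightarrow> 'a::real_normed_vector) \<Rightarrow> 'a \<Rightarrow> bool" where
  "initial_velocity T x v \<longleftrightarrow> (x has_vector_derivative v) (at 0 within {0..T})"

end

theory Submission
  imports Defs
begin

text \<open>Stacking real and imaginary parts is an injective real-linear map
  \<open>complex^'n \<rightarrow> real^('n + 'n)\<close>. It therefore commutes with differentiation in time, and it
  intertwines a complex matrix \<open>A\<close> with the real matrix with blocks
  \<open>Re A, - Im A, Im A, Re A\<close>. Each complex equation is carried to the corresponding real one, and
  injectivity gives the way back.\<close>

definition realify :: "complex^'n \<Rightarrow> real^('n + 'n)" where
  "realify v = block_vec (Re_vec v) (Im_vec v)"

lemma realify_nth [simp]:
  "realify v $ Inl i = Re (v $ i)" "realify v $ Inr i = Im (v $ i)"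
  by (simp_all add: realify_def block_vec_def Re_vec_def Im_vec_def)

lemma vec_sum_eq_iff:
  fixes x y :: "'a^('n::finite + 'm::finite)"
  shows "x = y \<longleftrightarrow> (\<forall>i. x $ Inl i = y $ Inl i) \<and> (\<forall>j. x $ Inr j = y $ Inr j)"
  by (metis vec_eq_iff sumE)

lemma realify_inject [simp]: "realify v = realify w \<longleftrightarrow> v = w"
  by (auto simp: vec_sum_eq_iff vec_eq_iff complex_eq_iff)

text \<open>In finite dimension linearity over the reals already gives boundedness. This is what
  lets time derivatives pass through \<open>realify\<close>.\<close>

lemma bounded_linear_realify: "bounded_linear realify"
  unfolding linear_conv_bounded_linear [symmetric]
  by (rule linearI) (simp_all add: vec_sum_eq_iff)

lemma sum_UNIV_sum:
  fixes f :: "'a::finite + 'b::finite \<Rightarrow> 'c::comm_monoid_add"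
  shows "sum f UNIV = (\<Sum>i\<in>UNIV. f (Inl i)) + (\<Sum>j\<in>UNIV. f (Inr j))"
  by (subst UNIV_Plus_UNIV [symmetric], subst sum.Plus) simp_all

lemma block_mat_mult_block_vec:
  "block_mat A B C D *v block_vec u v = block_vec (A *v u + B *v v) (C *v u + D *v v)"
  by (simp add: vec_sum_eq_iff matrix_vector_mult_def block_mat_def block_vec_def sum_UNIV_sum)

lemma Re_vec_mult:
  "Re_vec (A *v x) = map_matrix Re A *v Re_vec x - map_matrix Im A *v Im_vec x"
  by (simp add: vec_eq_iff Re_vec_def Im_vec_def matrix_vector_mult_def map_matrix_def
      sum_subtractf)

lemma Im_vec_mult:
  "Im_vec (A *v x) = map_matrix Im A *v Re_vec x + map_matrix Re A *v Im_vec x"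
  by (simp add: vec_eq_iff Re_vec_def Im_vec_def matrix_vector_mult_def map_matrix_def
      sum.distrib add.commute)

lemma minus_matrix_vector_mult:
  fixes A :: "'a::ring_1^'n^'m"
  shows "(- A) *v x = - (A *v x)"
  by (simp add: vec_eq_iff matrix_vector_mult_def sum_negf)

text \<open>The blocks give the standard real representation of a complex matrix: the two block rows
  compute the real and the imaginary part of \<open>A *v x\<close>.\<close>

lemma realify_mult:
  "block_mat (map_matrix Re A) (- map_matrix Im A) (map_matrix Im A) (map_matrix Re A) *v realify x
     = realify (A *v x)"
  by (simp add: realify_def block_mat_mult_block_vec Re_vec_mult Im_vec_mult
      minus_matrix_vector_mult)

lemma Re_vec_ii_scale: "Re_vec (\<i> *s v) = - Im_vec v"
  and Im_vec_ii_scale: "Im_vec (\<i> *s v) = Re_vec v"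
  by (simp_all add: vec_eq_iff Re_vec_def Im_vec_def)

text \<open>The pattern of \<open>realify_mult\<close> for iA in place of A, since Re(iA) = -Im A
  and Im(iA) = Re A. This accounts for the matrix in the real initial condition.\<close>

lemma realify_ii_mult:
  "block_mat (- map_matrix Im A) (- map_matrix Re A) (map_matrix Re A) (- map_matrix Im A)
     *v realify x = realify (\<i> *s (A *v x))"
  by (simp add: realify_def block_mat_mult_block_vec Re_vec_mult Im_vec_mult
      minus_matrix_vector_mult Re_vec_ii_scale Im_vec_ii_scale)

text \<open>An interval of positive length has no isolated points. Hence derivatives within it are
  unique, also the one-sided ones at the endpoints.\<close>

lemma at_within_Icc_neq_bot:
  fixes T t :: real
  assumes "T > 0" "t \<in> {0..T}"
  shows "at t within {0..T} \<noteq> bot"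
  using assms by (simp add: trivial_limit_within islimpt_Icc)

lemma tderiv_eqI:
  assumes "T > 0" "t \<in> {0..T}" "(f has_vector_derivative D) (at t within {0..T})"
  shows "tderiv T f t = D"
  unfolding tderiv_def using assms at_within_Icc_neq_bot vector_derivative_within by blast

lemma has_vector_derivative_tderiv:
  assumes "f differentiable_on {0..T}" "t \<in> {0..T}"
  shows "(f has_vector_derivative tderiv T f t) (at t within {0..T})"
  using assms by (simp add: tderiv_def differentiable_on_def vector_derivative_works)

text \<open>Agreement on the interval suffices, because the within-filter sees nothing else. This
  weak form is needed for \<open>tderiv T \<phi>\<close>, which is controlled only there.\<close>

lemma has_vector_derivative_realify:
  assumes "f differentiable_on {0..T}" "t \<in> {0..T}" "\<forall>s\<in>{0..T}. g s = realify (f s)"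
  shows "(g has_vector_derivative realify (tderiv T f t)) (at t within {0..T})"
proof (rule has_vector_derivative_transform)
  show "((\<lambda>s. realify (f s)) has_vector_derivative realify (tderiv T f t)) (at t within {0..T})"
    using assms has_vector_derivative_tderiv
    by (intro bounded_linear.has_vector_derivative [OF bounded_linear_realify])
qed (use assms in auto)

lemma differentiable_on_realify:
  fixes T :: real
  assumes "f differentiable_on {0..T}" "\<forall>s\<in>{0..T}. g s = realify (f s)"
  shows "g differentiable_on {0..T}"
  unfolding differentiable_on_def
  using assms differentiableI_vector has_vector_derivative_realify by blast

text \<open>The conclusion has the shape of the last hypothesis, one derivative higher, so the lemma
  can be iterated to reach second derivatives.\<close>

lemma tderiv_realify:
  assumes "T > 0" "f differentiable_on {0..T}" "\<forall>s\<in>{0..T}. g s = realify (f s)"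
  shows "\<forall>t\<in>{0..T}. tderiv T g t = realify (tderiv T f t)"
  using assms has_vector_derivative_realify tderiv_eqI by blast

lemma realify_minus: "realify (- v) = - realify v"
  by (simp add: vec_sum_eq_iff)

lemma solves_second_order_realify:
  assumes "T > 0" "twice_differentiable T \<psi>" "\<forall>t\<in>{0..T}. \<phi> t = realify (\<psi> t)"
  shows "solves_second_order T A \<psi> \<longleftrightarrow>
    solves_second_order T (\<lambda>t. block_mat (map_matrix Re (A t)) (- map_matrix Im (A t))
      (map_matrix Im (A t)) (map_matrix Re (A t))) \<phi>"
proof -
  have \<psi>: "\<psi> differentiable_on {0..T}" "tderiv T \<psi> differentiable_on {0..T}"
    using assms(2) by (auto simp: twice_differentiable_def)
  note \<phi>' = tderiv_realify [OF assms(1) \<psi>(1) assms(3)]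
  \<comment> \<open>Being a solution includes this regularity, so it has to be carried over from
    \<psi> as well.\<close>
  have "twice_differentiable T \<phi>"
    using differentiable_on_realify [OF \<psi>(1) assms(3)] differentiable_on_realify [OF \<psi>(2) \<phi>']
    by (simp add: twice_differentiable_def)
  \<comment> \<open>Both sides of the real equation become values of \<open>realify\<close>, which
    injectivity cancels at each time.\<close>
  then show ?thesis
    using assms tderiv_realify [OF assms(1) \<psi>(2) \<phi>']
    by (simp add: solves_second_order_def realify_mult flip: realify_minus)
qed

lemma initial_velocity_realify:
  assumes "T > 0" "\<psi> differentiable_on {0..T}" "\<forall>t\<in>{0..T}. \<phi> t = realify (\<psi> t)"
  shows "initial_velocity T \<psi> v \<longleftrightarrow> initial_velocity T \<phi> (realify v)"
proof -
  have 0: "0 \<in> {0..T}"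
    using assms(1) by simp
  \<comment> \<open>The derivative at 0 exists and is unique, so prescribing it means fixing the
    value of \<open>tderiv\<close>.\<close>
  have "initial_velocity T \<psi> v \<longleftrightarrow> tderiv T \<psi> 0 = v"
    unfolding initial_velocity_def
    using has_vector_derivative_tderiv [OF assms(2) 0] tderiv_eqI [OF assms(1) 0] by metis
  moreover have "initial_velocity T \<phi> (realify v) \<longleftrightarrow> realify (tderiv T \<psi> 0) = realify v"
    unfolding initial_velocity_def
    using has_vector_derivative_realify [OF assms(2) 0 assms(3)] tderiv_eqI [OF assms(1) 0]
    by metis
  ultimately show ?thesis
    by simp
qed

theorem mainTheorem4:
  fixes T :: real
    and n :: nat
    and H :: "real \<Rightarrow> complex^'N^'N"
    and \<psi> :: "real \<Rightarrow> complex^'N"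
    and \<phi> :: "real \<Rightarrow> real^('N + 'N)"
  assumes "CARD('N) = 2 ^ n"
    and "T > 0"
    and "continuously_differentiable T H"
    and "\<forall>t\<in>{0..T}. hermitian (H t)"
    and "twice_differentiable T \<psi>"
    and "\<forall>t\<in>{0..T}. \<phi> t = block_vec (Re_vec (\<psi> t)) (Im_vec (\<psi> t))"
  shows "let
      complex_ode = solves_second_order T (complex_K T H) \<psi>;
      real_ode = solves_second_order T (real_K T H) \<phi>;
      complex_ic = initial_velocity T \<psi> (- (\<i> *s (H 0 *v \<psi> 0)));
      real_ic = initial_velocity T \<phi>
        (- (block_mat (- map_matrix Im (H 0)) (- map_matrix Re (H 0))
                      (map_matrix Re (H 0)) (- map_matrix Im (H 0)) *v \<phi> 0))
    in (complex_ode \<longleftrightarrow> real_ode) \<and> (complex_ic \<longleftrightarrow> real_ic) \<and>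
       (complex_ode \<and> complex_ic \<longleftrightarrow> real_ode \<and> real_ic)"
proof -
  have \<phi>: "\<forall>t\<in>{0..T}. \<phi> t = realify (\<psi> t)"
    using assms(6) by (simp add: realify_def)
  have \<psi>: "\<psi> differentiable_on {0..T}"
    using assms(5) by (simp add: twice_differentiable_def)
  have ode: "solves_second_order T (complex_K T H) \<psi> \<longleftrightarrow> solves_second_order T (real_K T H) \<phi>"
    using solves_second_order_realify [OF assms(2,5) \<phi>, of "complex_K T H"]
    \<comment> \<open>\<open>real_K T H\<close> occurs without its time argument, so its definition
      is unfolded as a function of time.\<close>
    by (simp add: real_K_def [abs_def])
  have "\<phi> 0 = realify (\<psi> 0)"
    using \<phi> assms(2) by simp
  \<comment> \<open>Once \<phi> 0 is replaced by \<open>realify (\<psi> 0)\<close>, the real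
    velocity is \<open>realify\<close> of the complex one.\<close>
  then have ic: "initial_velocity T \<psi> (- (\<i> *s (H 0 *v \<psi> 0))) \<longleftrightarrow>
      initial_velocity T \<phi>
        (- (block_mat (- map_matrix Im (H 0)) (- map_matrix Re (H 0))
                      (map_matrix Re (H 0)) (- map_matrix Im (H 0)) *v \<phi> 0))"
    using initial_velocity_realify [OF assms(2) \<psi> \<phi>]
    by (simp only: realify_ii_mult flip: realify_minus)
  show ?thesis
    unfolding Let_def using ode ic by blast
qed

end
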